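(* Let $k\ge1$ be an integer. Every polynomial in $(\xi,\eta,\zeta)$ of total degree at most $k-1$, restricted to $\Omega$, belongs to $\mathcal U^{(3),k}(\Omega)$; that is, $P^{k-1}(\Omega)\subset\mathcal U^{(3),k}(\Omega)$.
   Context: $\Omega=\{(\xi,\eta,\zeta)\in\mathbb R^3:\xi,\eta,\zeta\ge0,\ \xi\le1-\zeta,\ \eta\le1-\zeta\}$; $\Omega_\infty=\{(x,y,z):0\le x,y\le1,\ z\ge0\}$; $\phi:\Omega_\infty\to\Omega$, $\phi(x,y,z)=\left(\frac{x}{1+z},\frac{y}{1+z},\frac{z}{1+z}\right)$, a diffeomorphism onto $\Omega$ minus its apex $(0,0,1)$. For 3-forms (scalar functions $q$) $\phi^*q=|D\phi|(q\circ\phi)$ with $|D\phi|=(1+z)^{-4}$ the Jacobian determinant. $Q^{l,m,n}_k$ is the space of functions $u/(1+z)^k$ with $u$ a polynomial of degree at most $l,m,n$ in $x,y,z$ respectively. $\mathcal U^{(3),k}(\Omega)=\{q:\phi^*q\in Q_{k+3}^{k-1,k-1,k-1}\}$. *)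

theory Defs
  imports "HOL-Analysis.Analysis"
begin

text \<open>
  Functions on a subset of \<open>\<real>\<^sup>3\<close> are represented extensionally, so that two functions with
  the same values on their domain are equal. In \<^typ>\<open>real ^ 3\<close> the components 1, 2, 3 are
  \<open>\<xi>, \<eta>, \<zeta>\<close> on the pyramid and \<open>x, y, z\<close> on the infinite pyramid.
\<close>

definition pyramid :: "(real ^ 3) set" (\<open>\<Omega>\<close>) where
  "\<Omega> = {p. p $ 1 \<ge> 0 \<and> p $ 2 \<ge> 0 \<and> p $ 3 \<ge> 0 \<and> p $ 1 \<le> 1 - p $ 3 \<and> p $ 2 \<le> 1 - p $ 3}"

definition inf_pyramid :: "(real ^ 3) set" (\<open>\<Omega>\<^sub>\<infinity>\<close>) where
  "\<Omega>\<^sub>\<infinity> = {p. 0 \<le> p $ 1 \<and> p $ 1 \<le> 1 \<and> 0 \<le> p $ 2 \<and> p $ 2 \<le> 1 \<and> p $ 3 \<ge> 0}"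

definition pyr_map :: "real ^ 3 \<Rightarrow> real ^ 3" where
  "pyr_map p = vector [p $ 1 / (1 + p $ 3), p $ 2 / (1 + p $ 3), p $ 3 / (1 + p $ 3)]"

text \<open>
  The formula for \<^const>\<open>pyr_map\<close> is smooth on the open half space \<open>z > -1\<close>, which contains
  \<open>\<Omega>\<^sub>\<infinity>\<close>, so the unrestricted derivative is the right one also at boundary points.
\<close>

definition pyr_jacobian :: "real ^ 3 \<Rightarrow> real" where
  "pyr_jacobian p = det (matrix (frechet_derivative pyr_map (at p)))"

definition pullback3 :: "(real ^ 3 \<Rightarrow> real) \<Rightarrow> (real ^ 3 \<Rightarrow> real)" where
  "pullback3 q = (\<lambda>p\<in>\<Omega>\<^sub>\<infinity>. pyr_jacobian p * q (pyr_map p))"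

text \<open>
  Polynomial functions on \<open>\<real>\<^sup>3\<close> all of whose monomials have their exponent triple in the
  set \<open>S\<close> (meant to be finite).
\<close>

definition polys_with_exponents :: "(nat \<times> nat \<times> nat) set \<Rightarrow> (real ^ 3 \<Rightarrow> real) set" where
  "polys_with_exponents S =
     {u. \<exists>c :: nat \<Rightarrow> nat \<Rightarrow> nat \<Rightarrow> real.
           \<forall>p. u p = (\<Sum>(a, b, d)\<in>S. c a b d * (p $ 1) ^ a * (p $ 2) ^ b * (p $ 3) ^ d)}"

definition Q_space :: "nat \<Rightarrow> nat \<Rightarrow> nat \<Rightarrow> nat \<Rightarrow> (real ^ 3 \<Rightarrow> real) set" where
  "Q_space l m n k =
     {(\<lambda>p\<in>\<Omega>\<^sub>\<infinity>. u p / (1 + p $ 3) ^ k) | u. u \<in> polys_with_exponents ({..l} \<times> {..m} \<times> {..n})}"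

text \<open>For \<open>k \<ge> 1\<close>; the subtraction on \<^typ>\<open>nat\<close> truncates for \<open>k = 0\<close>.\<close>

definition U3_space :: "nat \<Rightarrow> (real ^ 3 \<Rightarrow> real) set" where
  "U3_space k = {q \<in> extensional \<Omega>. pullback3 q \<in> Q_space (k - 1) (k - 1) (k - 1) (k + 3)}"

definition P_space :: "nat \<Rightarrow> (real ^ 3 \<Rightarrow> real) set" where
  "P_space d = {restrict u \<Omega> | u. u \<in> polys_with_exponents {(a, b, c). a + b + c \<le> d}}"

end

theory Submission
  imports Defs
begin

text \<open>
  With \<open>n = k - 1\<close>, the Jacobian \<open>(1 + z)\<^sup>-\<^sup>4\<close> times the pullback of \<open>\<xi>\<^sup>a \<eta>\<^sup>b \<zeta>\<^sup>d\<close> is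
  \<open>x\<^sup>a y\<^sup>b z\<^sup>d (1 + z)\<^bsup>n - (a + b + d)\<^esup> / (1 + z)\<^bsup>k + 3\<^esup>\<close>. For \<open>a + b + d \<le> n\<close> the numerator is a
  polynomial, and its degree in \<open>z\<close> is \<open>n - a - b\<close>.
\<close>

text \<open>A vector is the sum of its components times the fixed vectors \<open>axis i 1\<close>,
  so differentiability passes from the three scalar components to the whole map.\<close>

lemma has_derivative_vec3:
  fixes f :: "'a::euclidean_space \<Rightarrow> real ^ 3"
  assumes "((\<lambda>p. f p $ 1) has_derivative (\<lambda>h. f' h $ 1)) F"
    and "((\<lambda>p. f p $ 2) has_derivative (\<lambda>h. f' h $ 2)) F"
    and "((\<lambda>p. f p $ 3) has_derivative (\<lambda>h. f' h $ 3)) F"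
  shows "(f has_derivative f') F"
proof -
  have "((\<lambda>p. f p $ i) has_derivative (\<lambda>h. f' h $ i)) F" for i
    using assms exhaust_3[of i] by auto
  then have "((\<lambda>p. \<Sum>i\<in>UNIV. f p $ i *\<^sub>R axis i (1::real)) has_derivative
      (\<lambda>h. \<Sum>i\<in>UNIV. f' h $ i *\<^sub>R axis i 1)) F"
    by (intro has_derivative_sum has_derivative_scaleR_left)
  moreover have "(\<Sum>i\<in>UNIV. v $ i *\<^sub>R axis i (1::real)) = v" for v :: "real ^ 3"
    using basis_expansion[of v] by (simp add: scalar_mult_eq_scaleR)
  ultimately show ?thesis
    by simp
qed

lemma has_derivative_pyr_map:
  assumes "1 + p $ 3 \<noteq> 0"
  shows "(pyr_map has_derivative (\<lambda>h. vector
           [h $ 1 / (1 + p $ 3) - p $ 1 * h $ 3 / (1 + p $ 3) ^ 2,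
            h $ 2 / (1 + p $ 3) - p $ 2 * h $ 3 / (1 + p $ 3) ^ 2,
            h $ 3 / (1 + p $ 3) ^ 2])) (at p)"
proof -
  have nth: "((\<lambda>x::real^3. x $ i) has_derivative (\<lambda>h. h $ i)) (at p)" for i
    by (rule bounded_linear.has_derivative[OF bounded_linear_vec_nth has_derivative_ident])
  have quotient: "((\<lambda>x. x $ i / (1 + x $ 3)) has_derivative
      (\<lambda>h. h $ i / (1 + p $ 3) - p $ i * h $ 3 / (1 + p $ 3) ^ 2)) (at p)" for i
    by (rule has_derivative_eq_rhs[OF has_derivative_divide'
          [OF nth has_derivative_add[OF has_derivative_const nth] assms]])
      (use assms in \<open>simp add: fun_eq_iff diff_divide_distrib power2_eq_square\<close>)
  \<comment> \<open>For \<open>i = 3\<close> the two terms of the quotient rule merge, since z / (1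
    + z) has derivative 1 / (1 + z)^2.\<close>
  have "h $ 3 / (1 + p $ 3) - p $ 3 * h $ 3 / (1 + p $ 3) ^ 2 = h $ 3 / (1 + p $ 3) ^ 2"
    for h :: "real ^ 3"
  proof -
    have "h $ 3 / (1 + p $ 3) = h $ 3 * (1 + p $ 3) / (1 + p $ 3) ^ 2"
      using assms by (simp add: power2_eq_square)
    then show ?thesis
      by (simp add: algebra_simps flip: diff_divide_distrib)
  qed
  then show ?thesis
    using quotient[of 1] quotient[of 2] quotient[of 3]
    by (intro has_derivative_vec3) (simp_all add: pyr_map_def)
qed

text \<open>The third component depends on z alone and the first two only on their own variable and
  z. The matrix is therefore upper triangular, with diagonal 1 / (1 + z), 1 / (1 + z), 1 / (1 +
  z)^2.\<close>

lemma pyr_jacobian_eq: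
  assumes "1 + p $ 3 \<noteq> 0"
  shows "pyr_jacobian p = 1 / (1 + p $ 3) ^ 4"
proof -
  have "pyr_jacobian p = 1 / (1 + p $ 3) * (1 / (1 + p $ 3)) * (1 / (1 + p $ 3) ^ 2)"
    by (simp add: pyr_jacobian_def det_3 matrix_def axis_def
        frechet_derivative_at[OF has_derivative_pyr_map[OF assms], symmetric])
  then show ?thesis
    by (simp flip: power_Suc power_add add: power2_eq_square power4_eq_xxxx)
qed

text \<open>Needed because \<open>restrict u \<Omega>\<close> agrees with \<open>u\<close> only on
  \<open>\<Omega>\<close>. As 1 - \<zeta> = 1 / (1 + z), the slanted faces correspond to x \<le> 1
  and y \<le> 1.\<close>

lemma pyr_map_in_pyramid:
  assumes "p \<in> \<Omega>\<^sub>\<infinity>"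
  shows "pyr_map p \<in> \<Omega>"
proof -
  have "0 \<le> p $ 3"
    using assms by (simp add: inf_pyramid_def)
  then have "1 - p $ 3 / (1 + p $ 3) = 1 / (1 + p $ 3)"
    by (simp add: field_simps)
  with \<open>0 \<le> p $ 3\<close> show ?thesis
    using assms by (simp add: inf_pyramid_def pyramid_def pyr_map_def divide_right_mono)
qed

lemma polys_with_exponents_sum:
  assumes "\<And>i. i \<in> I \<Longrightarrow> f i \<in> polys_with_exponents S"
  shows "(\<lambda>p. \<Sum>i\<in>I. f i p) \<in> polys_with_exponents S"
proof -
  have "\<forall>i\<in>I. \<exists>c. \<forall>p.
      f i p = (\<Sum>(a, b, d)\<in>S. c a b d * (p $ 1) ^ a * (p $ 2) ^ b * (p $ 3) ^ d)"
    using assms by (simp add: polys_with_exponents_def)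
  then obtain C where "\<forall>i\<in>I. \<forall>p.
      f i p = (\<Sum>(a, b, d)\<in>S. C i a b d * (p $ 1) ^ a * (p $ 2) ^ b * (p $ 3) ^ d)"
    by (rule bchoice[THEN exE])
  then have C: "f i p = (\<Sum>(a, b, d)\<in>S. C i a b d * (p $ 1) ^ a * (p $ 2) ^ b * (p $ 3) ^ d)"
    if "i \<in> I" for i p
    using that by simp
  have "(\<Sum>i\<in>I. f i p) = (\<Sum>(a, b, d)\<in>S. (\<Sum>i\<in>I. C i a b d) * (p $ 1) ^ a * (p $ 2) ^ b * (p $ 3) ^ d)"
    for p
  proof -
    have "(\<Sum>i\<in>I. f i p) =
        (\<Sum>i\<in>I. \<Sum>(a, b, d)\<in>S. C i a b d * (p $ 1) ^ a * (p $ 2) ^ b * (p $ 3) ^ d)"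
      by (simp add: C)
    also have "\<dots> = (\<Sum>t\<in>S. \<Sum>i\<in>I. case t of (a, b, d) \<Rightarrow> C i a b d * (p $ 1) ^ a * (p $ 2) ^ b * (p $ 3) ^ d)"
      by (rule sum.swap)
    finally show ?thesis
      by (simp add: case_prod_unfold sum_distrib_right)
  qed
  then show ?thesis
    unfolding polys_with_exponents_def mem_Collect_eq
    by (intro exI[of _ "\<lambda>a b d. \<Sum>i\<in>I. C i a b d"]) blast
qed

text \<open>The coefficient family is \<open>c\<close> at one triple and 0 elsewhere. Finiteness of
  \<open>S\<close> matters: a sum over an infinite set is 0 by convention.\<close>

lemma monomial_in_polys_with_exponents:
  assumes "finite S" "(a, b, d) \<in> S"
  shows "(\<lambda>p. c * (p $ 1) ^ a * (p $ 2) ^ b * (p $ 3) ^ d) \<in> polys_with_exponents S"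
proof -
  let ?C = "\<lambda>a' b' d'. if (a', b', d') = (a, b, d) then c else 0"
  have "c * (p $ 1) ^ a * (p $ 2) ^ b * (p $ 3) ^ d =
      (\<Sum>(a', b', d')\<in>S. ?C a' b' d' * (p $ 1) ^ a' * (p $ 2) ^ b' * (p $ 3) ^ d')" for p :: "real ^ 3"
  proof -
    have "(\<Sum>(a', b', d')\<in>S. ?C a' b' d' * (p $ 1) ^ a' * (p $ 2) ^ b' * (p $ 3) ^ d') =
        (\<Sum>t\<in>S. if t = (a, b, d) then c * (p $ 1) ^ a * (p $ 2) ^ b * (p $ 3) ^ d else 0)"
      by (rule sum.cong) (auto split: if_splits)
    then show ?thesis
      using assms by simp
  qed
  then show ?thesis
    unfolding polys_with_exponents_def mem_Collect_eq by (intro exI[of _ ?C]) blast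
qed

text \<open>Expand the power of 1 + z by the binomial theorem; the exponents \<open>d + j\<close> of
  z stay at most n - a - b.\<close>

lemma homogenized_monomial_in_polys_with_exponents:
  assumes "a + b + d \<le> n"
  shows "(\<lambda>p. c * (p $ 1) ^ a * (p $ 2) ^ b * (p $ 3) ^ d * (1 + p $ 3) ^ (n - (a + b + d)))
    \<in> polys_with_exponents ({..n} \<times> {..n} \<times> {..n})"
proof -
  let ?m = "n - (a + b + d)"
  have "(\<lambda>p. \<Sum>j\<le>?m. c * of_nat (?m choose j) * (p $ 1) ^ a * (p $ 2) ^ b * (p $ 3) ^ (d + j))
      \<in> polys_with_exponents ({..n} \<times> {..n} \<times> {..n})"
    using assms by (intro polys_with_exponents_sum monomial_in_polys_with_exponents) auto
  moreover have "c * x ^ a * y ^ b * z ^ d * (1 + z) ^ ?m =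
      (\<Sum>j\<le>?m. c * of_nat (?m choose j) * x ^ a * y ^ b * z ^ (d + j))" for x y z :: real
    using binomial_ring[of z 1 ?m]
    by (simp add: sum_distrib_left power_add add.commute mult_ac)
  ultimately show ?thesis
    by simp
qed

theorem lemma8p1:
  fixes k :: nat
  assumes "k \<ge> 1"
  shows "P_space (k - 1) \<subseteq> U3_space k"
proof
  fix q
  assume "q \<in> P_space (k - 1)"
  define n where "n = k - 1"
  define S where "S = {(a, b, d). a + b + d \<le> n}"
  obtain u where u: "u \<in> polys_with_exponents S" and q: "q = restrict u \<Omega>"
    using \<open>q \<in> P_space (k - 1)\<close> by (auto simp: P_space_def S_def n_def)
  obtain c where c: "\<And>p. u p = (\<Sum>(a, b, d)\<in>S. c a b d * (p $ 1) ^ a * (p $ 2) ^ b * (p $ 3) ^ d)"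
    using u by (auto simp: polys_with_exponents_def)
  \<comment> \<open>The numerator of the pullback over the common denominator: each monomial lacks n
    - (a + b + d) factors 1 + z, which are supplied here.\<close>
  define v where "v = (\<lambda>p::real^3. \<Sum>t\<in>S. case t of (a, b, d) \<Rightarrow>
      c a b d * (p $ 1) ^ a * (p $ 2) ^ b * (p $ 3) ^ d * (1 + p $ 3) ^ (n - (a + b + d)))"
  have "v \<in> polys_with_exponents ({..n} \<times> {..n} \<times> {..n})"
    unfolding v_def
    by (rule polys_with_exponents_sum)
      (auto simp: S_def intro: homogenized_monomial_in_polys_with_exponents)
  moreover have "pullback3 q = (\<lambda>p\<in>\<Omega>\<^sub>\<infinity>. v p / (1 + p $ 3) ^ (k + 3))"
    unfolding pullback3_def
  proof (rule restrict_ext)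
    fix p :: "real ^ 3"
    assume p: "p \<in> \<Omega>\<^sub>\<infinity>"
    define w where "w = 1 + p $ 3"
    have w: "w \<noteq> 0"
      using p by (simp add: w_def inf_pyramid_def)
    \<comment> \<open>The exponent splits into \<open>n\<close> from the common denominator and 4
      from the Jacobian; \<open>k \<ge> 1\<close> rules out truncation in
      \<open>k - 1\<close>.\<close>
    have k: "k + 3 = n + 4"
      using assms by (simp add: n_def)
    have "u (pyr_map p) = v p / w ^ n"
      unfolding c v_def sum_divide_distrib
    proof (rule sum.cong, goal_cases)
      case (2 t)
      then obtain a b d where t: "t = (a, b, d)" and le: "a + b + d \<le> n"
        by (auto simp: S_def)
      \<comment> \<open>The first three factors are the denominators of the powers of x / w, y / w
        and z / w; the last cancels the factor added in \<open>v\<close>.\<close>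
      from le have "w ^ n = w ^ a * w ^ b * w ^ d * w ^ (n - (a + b + d))"
        by (simp flip: power_add)
      then show ?case
        using w by (simp add: t pyr_map_def power_divide flip: w_def)
    qed simp
    then show "pyr_jacobian p * q (pyr_map p) = v p / (1 + p $ 3) ^ (k + 3)"
      using p w pyr_map_in_pyramid[OF p] pyr_jacobian_eq[of p]
      by (simp add: q k power_add mult.commute flip: w_def)
  qed
  ultimately have "pullback3 q \<in> Q_space n n n (k + 3)"
    by (auto simp: Q_space_def)
  then show "q \<in> U3_space k"
    by (simp add: U3_space_def q n_def)
qed

end
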